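(* The constant $\frac{7}{8}$ in the inequality $e(G^3) \ge \frac{7}{8}\,\delta(G)\,v(G)$ for finite simple connected graphs $G$ of diameter at least $3$ is best possible, even for regular graphs: for every real number $c > \frac{7}{8}$ there exists a finite simple connected regular graph $G$ of diameter at least $3$ such that $e(G^3) < c\,\delta(G)\,v(G)$.
   Context: All graphs are simple. For a graph $G$, $v(G)$ and $e(G)$ denote its numbers of vertices and edges respectively, and $\delta(G)$ denotes its minimum degree. For a positive integer $k$, the $k$-th power $G^k$ is the simple graph with vertex set $V(G)$ in which two distinct vertices are adjacent if and only if their distance in $G$ is at most $k$. The diameter of a connected graph is the maximum distance between a pair of its vertices. A graph is regular if all its vertices have the same degree. *)

theory Defs
  imports "Graph_Theory.Graph_Theory"
begin

text \<open>
  A finite simple graph is a \<^locale>\<open>pair_graph\<close>: a finite loop-free digraph whose arc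
  relation is symmetric. Each undirected edge is thus represented by two opposite arcs, and the
  degree of a vertex is its out-degree.
\<close>

definition num_verts :: "'a pair_pre_digraph \<Rightarrow> nat" where
  "num_verts G = card (pverts G)"

text \<open>Undirected edges are counted as unordered pairs, so two opposite arcs count once.\<close>

definition num_edges :: "'a pair_pre_digraph \<Rightarrow> nat" where
  "num_edges G = card {{u, v} |u v. (u, v) \<in> parcs G}"

definition degree :: "'a pair_pre_digraph \<Rightarrow> 'a \<Rightarrow> nat" where
  "degree G v = out_degree (with_proj G) v"

definition min_degree :: "'a pair_pre_digraph \<Rightarrow> nat" where
  "min_degree G = Min (degree G ` pverts G)"

definition regular_graph :: "'a pair_pre_digraph \<Rightarrow> bool" where
  "regular_graph G \<longleftrightarrow> (\<exists>d. \<forall>v\<in>pverts G. degree G v = d)"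

text \<open>Distance is the shortest-path weight for unit arc weights, hence the least number of
  edges of a walk from \<open>u\<close> to \<open>v\<close>, and \<open>\<infinity>\<close> if there is none.\<close>

definition graph_dist :: "'a pair_pre_digraph \<Rightarrow> 'a \<Rightarrow> 'a \<Rightarrow> ereal" where
  "graph_dist G u v = wf_digraph.\<mu> (with_proj G) (\<lambda>_. 1) u v"

text \<open>For a finite connected graph the supremum is a maximum.\<close>

definition graph_diameter :: "'a pair_pre_digraph \<Rightarrow> ereal" where
  "graph_diameter G = (SUP (u, v) \<in> pverts G \<times> pverts G. graph_dist G u v)"

definition graph_power :: "'a pair_pre_digraph \<Rightarrow> nat \<Rightarrow> 'a pair_pre_digraph" where
  "graph_power G k = \<lparr> pverts = pverts G,
     parcs = {(u, v). u \<in> pverts G \<and> v \<in> pverts G \<and> u \<noteq> v \<and> graph_dist G u v \<le> ereal (real k)} \<rparr>"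

end

theory Submission
  imports Defs
begin

text \<open>
  If a vertex at one end of a path-like layered graph has degree \<open>d\<close>, its closed neighbourhood takes
  up about \<open>d\<close> vertices, and likewise at the other end. The examples consist of little else: five
  layers of sizes \<open>q + 1, q, 1, q, q + 1\<close>, where vertices are joined exactly when their layers are
  equal or consecutive, except that a perfect matching is removed from each layer of size \<open>q\<close>.
  Then \<open>d = 2q\<close> and \<open>n = 4q + 3\<close>. Only the \<open>(q + 1)\<^sup>2\<close> pairs between the two outermost layers
  have distance greater than three, so the cube has
  \<open>(4q + 3)(2q + 1) - (q + 1)\<^sup>2 = 7q\<^sup>2 + 8q + 2\<close> edges, against \<open>d n = 8q\<^sup>2 + 6q\<close>. The quotient
  tends to \<open>7 / 8\<close>.

  The single vertex in the middle is a bottleneck that contributes nothing to the leading term: it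
  separates the outermost layers by distance four without adding to the number of vertices. The
  matchings serve to make the graph exactly regular. With complete layers, an outermost vertex would
  have degree \<open>2q\<close> and its neighbours in the next layer \<open>2q + 1\<close>, because of their arc to the
  middle; deleting one arc at each of the latter restores the balance, and this needs \<open>q\<close> even.
  All distance bounds come from the fact that the layer number changes by at most one along an arc
  (\<open>potential_le_graph_dist\<close>); the count itself is \<open>num_edges_cube_layered\<close>.
\<close>

text \<open>A function that rises by at most one along each arc bounds the length of every walk from below,
  and hence the infimum that defines the distance; if there is no walk, that infimum is \<open>\<infinity>\<close>.\<close>

lemma potential_le_graph_dist:
  fixes f :: "'a \<Rightarrow> real"
  assumes wf: "pair_wf_digraph G"
    and step: "\<And>x y. (x, y) \<in> parcs G \<Longrightarrow> f y \<le> f x + 1"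
  shows "ereal (f v - f u) \<le> graph_dist G u v"
proof -
  interpret pair_wf_digraph G by (rule wf)
  have len: "f v - f u \<le> awalk_cost (\<lambda>_. 1) p" if "pcas u p v" "set p \<subseteq> parcs G" for p u
    using that
  proof (induction p arbitrary: u)
    case (Cons e p)
    then have "f v - f (snd e) \<le> awalk_cost (\<lambda>_. 1) p" by simp
    moreover have "f (snd e) \<le> f u + 1" using Cons.prems step[of u "snd e"] by (cases e) auto
    ultimately show ?case by simp
  qed simp
  show ?thesis
    unfolding graph_dist_def \<mu>_def
  proof (rule INF_greatest)
    fix p assume "p \<in> {p. awalk u p v}"
    then show "ereal (f v - f u) \<le> ereal (awalk_cost (\<lambda>_. 1) p)"
      using len[of u p] by (auto simp: awalk_def)
  qed
qed

definition layer :: "nat \<Rightarrow> nat \<Rightarrow> nat" where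
  "layer q u = (if u \<le> q then 0 else if u \<le> 2*q then 1 else if u = 2*q+1 then 2
                else if u \<le> 3*q+1 then 3 else 4)"

text \<open>The removed matchings pair each vertex of an inner layer with its mirror image: \<open>3q + 1\<close> and
  \<open>5q + 3\<close> are the sums of the first and last elements of layers 1 and 3. Both are odd for even
  \<open>q\<close>, so that no vertex is its own mirror image.\<close>

definition layered :: "nat \<Rightarrow> nat pair_pre_digraph" where
  "layered q = \<lparr> pverts = {..4*q+2},
     parcs = {(u, v). u \<le> 4*q+2 \<and> v \<le> 4*q+2 \<and> u \<noteq> v \<and>
       layer q u \<le> layer q v + 1 \<and> layer q v \<le> layer q u + 1 \<and>
       \<not> (layer q u = 1 \<and> layer q v = 1 \<and> u + v = 3*q+1) \<and>
       \<not> (layer q u = 3 \<and> layer q v = 3 \<and> u + v = 5*q+3)} \<rparr>"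

lemma pair_graph_layered: "pair_graph (layered q)"
proof -
  have "finite (parcs (layered q))"
    by (rule finite_subset[of _ "{..4*q+2} \<times> {..4*q+2}"]) (auto simp: layered_def)
  then show ?thesis
    by unfold_locales (auto simp: layered_def symmetric_def sym_def add.commute)
qed

lemma degree_layered:
  assumes "even q" "u \<in> pverts (layered q)"
  shows "degree (layered q) u = 2 * q"
proof -
  define N where "N = {v. (u, v) \<in> parcs (layered q)}"
  have "out_arcs (with_proj (layered q)) u = Pair u ` N"
    by (auto simp: out_arcs_def N_def)
  then have "degree (layered q) u = card N"
    by (simp add: degree_def out_degree_def card_image inj_on_def)
  moreover have "card N = 2 * q"
  proof -
    obtain r where q: "q = 2 * r" using assms(1) by blast
    have u: "u \<le> 4*q+2" using assms(2) by (simp add: layered_def)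
    consider "u \<le> q" | "q < u" "u \<le> 2*q" | "u = 2*q+1" | "2*q+1 < u" "u \<le> 3*q+1" | "3*q+1 < u"
      by linarith
    then show ?thesis
    proof cases
      case 1
      then have "N = {..2*q} - {u}"
        by (auto simp: N_def layered_def layer_def split: if_splits)
      then show ?thesis using 1 by simp
    next
      case 2
      have "N = {..2*q+1} - {u, 3*q+1-u}"
        using 2 by (auto simp: N_def layered_def layer_def split: if_splits)
      moreover have "u \<noteq> 3*q+1-u" unfolding q by presburger
      ultimately show ?thesis using 2 by (simp add: card_Diff_subset)
    next
      case 3
      then have "N = {q+1..2*q} \<union> {2*q+2..3*q+1}"
        by (auto simp: N_def layered_def layer_def split: if_splits)
      then show ?thesis by (simp add: card_Un_disjoint)
    next
      case 4
      have "N = {2*q+1..4*q+2} - {u, 5*q+3-u}"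
        using 4 by (auto simp: N_def layered_def layer_def split: if_splits)
      moreover have "{u, 5*q+3-u} \<subseteq> {2*q+1..4*q+2}" using 4 by auto
      ultimately have "card N = card {2*q+1..4*q+2} - card {u, 5*q+3-u}"
        by (simp only: card_Diff_subset finite.intros)
      moreover have "u \<noteq> 5*q+3-u" unfolding q by presburger
      ultimately show ?thesis by simp
    next
      case 5
      then have "N = {2*q+2..4*q+2} - {u}"
        using u by (auto simp: N_def layered_def layer_def split: if_splits)
      then show ?thesis using 5 u by simp
    qed
  qed
  ultimately show ?thesis by simp
qed

lemma min_degree_layered:
  assumes "even q"
  shows "min_degree (layered q) = 2 * q"
proof -
  have "degree (layered q) ` pverts (layered q) = (\<lambda>_. 2 * q) ` pverts (layered q)"
    using degree_layered[OF assms] by (intro image_cong) auto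
  also have "\<dots> = {2 * q}" by (auto simp: layered_def)
  finally show ?thesis by (simp add: min_degree_def)
qed

text \<open>Every vertex reaches the middle one: directly from an inner layer, and in two steps from an
  outermost one.\<close>

lemma connected_layered:
  assumes "q > 0"
  shows "Digraph_Component.connected (with_proj (layered q))"
proof -
  interpret pair_graph "layered q" by (rule pair_graph_layered)
  let ?w = "2*q+1"
  have arc: "u \<rightarrow>\<^sup>*\<^bsub>with_proj (layered q)\<^esub> v" if "(u, v) \<in> parcs (layered q)" for u v
    using that by (intro reachable_adjI) simp
  have to_hub: "u \<rightarrow>\<^sup>*\<^bsub>with_proj (layered q)\<^esub> ?w" if u: "u \<le> 4*q+2" for u
  proof (cases "u = ?w")
    case True
    have "?w \<in> pverts (layered q)" by (simp add: layered_def)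
    then show ?thesis using True by (simp add: reachable_refl)
  next
    case False
    show ?thesis
    proof (cases "layer q u \<in> {1, 3}")
      case True
      then show ?thesis using u False by (intro arc) (auto simp: layered_def layer_def split: if_splits)
    next
      case 2: False
      define x where "x = (if u < ?w then q+1 else 3*q+1)"
      have "(u, x) \<in> parcs (layered q)" "(x, ?w) \<in> parcs (layered q)"
        using u False 2 assms by (auto simp: x_def layered_def layer_def split: if_splits)
      then show ?thesis by (meson arc reachable_trans)
    qed
  qed
  have "u \<rightarrow>\<^sup>*\<^bsub>with_proj (layered q)\<^esub> v" if "u \<le> 4*q+2" "v \<le> 4*q+2" for u v
    using to_hub that by (meson symmetric_reachable sym_arcs reachable_trans)
  then have "strongly_connected (with_proj (layered q))"
    by (auto simp: strongly_connected_def layered_def)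
  then show ?thesis
    unfolding connected_def strongly_connected_def
    by (simp add: reachable_mk_symmetricI)
qed

lemma layer_diff_le_graph_dist:
  "ereal \<bar>real (layer q v) - real (layer q u)\<bar> \<le> graph_dist (layered q) u v"
proof -
  have wf: "pair_wf_digraph (layered q)"
    using pair_graph_layered by (auto simp: pair_graph_def pair_digraph_def pair_fin_digraph_def)
  have "ereal (real (layer q v) - real (layer q u)) \<le> graph_dist (layered q) u v"
    by (rule potential_le_graph_dist[OF wf]) (auto simp: layered_def)
  moreover have "ereal (- real (layer q v) - - real (layer q u)) \<le> graph_dist (layered q) u v"
    by (rule potential_le_graph_dist[OF wf]) (auto simp: layered_def)
  ultimately show ?thesis by (auto simp: abs_if)
qed

lemma diameter_layered: "graph_diameter (layered q) \<ge> 3"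
proof -
  have "(3::ereal) \<le> ereal \<bar>real (layer q (4*q+2)) - real (layer q 0)\<bar>"
    by (simp add: layer_def)
  also have "\<dots> \<le> graph_dist (layered q) 0 (4*q+2)" by (rule layer_diff_le_graph_dist)
  also have "\<dots> \<le> graph_diameter (layered q)"
    unfolding graph_diameter_def by (rule SUP_upper2[of "(0, 4*q+2)"]) (auto simp: layered_def)
  finally show ?thesis .
qed

text \<open>The unordered pairs between the outermost layers, whose layer numbers differ by four, are not
  edges of the cube; together with the edges they still fit into the set of all 2-subsets.\<close>

lemma num_edges_cube_layered:
  "num_edges (graph_power (layered q) 3) + (q+1)^2 \<le> (4*q+3) * (2*q+1)"
proof -
  define E where "E = {{u, v} |u v. (u, v) \<in> parcs (graph_power (layered q) 3)}"
  define F where "F = (\<lambda>(u, v). {u, v}) ` ({..q} \<times> {3*q+2..4*q+2})"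
  define P where "P = {B. B \<subseteq> {..4*q+2} \<and> card B = 2}"
  have finP: "finite P" unfolding P_def by (rule finite_subset[of _ "Pow {..4*q+2}"]) auto
  have layers: "\<bar>real (layer q v) - real (layer q u)\<bar> \<le> 3" if "(u, v) \<in> parcs (graph_power (layered q) 3)" for u v
  proof -
    have "graph_dist (layered q) u v \<le> ereal 3" using that by (simp add: graph_power_def)
    from order_trans[OF layer_diff_le_graph_dist this] show ?thesis by simp
  qed
  have sub: "E \<subseteq> P" "F \<subseteq> P"
    by (auto simp: E_def F_def P_def graph_power_def layered_def)
  have "E \<inter> F = {}"
  proof -
    have False if "(u, v) \<in> parcs (graph_power (layered q) 3)" "{u, v} = {x, y}"
      "x \<le> q" "3*q+2 \<le> y" for u v x y
    proof -
      have "layer q x = 0" "layer q y = 4" using that by (auto simp: layer_def)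
      then show False using layers[OF that(1)] that(2) by (auto simp: doubleton_eq_iff)
    qed
    note disj = this
    show ?thesis
    proof (rule equals0I)
      fix S assume "S \<in> E \<inter> F"
      then obtain u v x y where "(u, v) \<in> parcs (graph_power (layered q) 3)" "S = {u, v}"
        "x \<le> q" "3*q+2 \<le> y" "S = {x, y}"
        unfolding E_def F_def by auto
      then show False using disj[of u v x y] by simp
    qed
  qed
  moreover have "card F = (q+1)^2"
  proof -
    have "inj_on (\<lambda>(u, v). {u, v}) ({..q} \<times> {3*q+2..4*q+2})"
      by (auto simp: inj_on_def doubleton_eq_iff)
    then show ?thesis by (simp add: F_def card_image card_cartesian_product power2_eq_square)
  qed
  moreover have "card P = (4*q+3) * (2*q+1)"
  proof -
    have "card P = (4*q+3) choose 2"
      unfolding P_def by (subst n_subsets) (simp_all add: numeral_3_eq_3)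
    also have "\<dots> = (4*q+3) * (2 * (2*q+1)) div 2" by (simp add: choose_two)
    also have "\<dots> = (4*q+3) * (2*q+1)" by (simp only: mult.left_commute[of _ 2])
    finally show ?thesis .
  qed
  ultimately show ?thesis
    using card_mono[OF finP, of "E \<union> F"] sub finite_subset[OF _ finP]
    by (auto simp: num_edges_def E_def[symmetric] card_Un_disjoint)
qed

theorem mainTheorem2:
  fixes c :: real
  assumes "c > 7 / 8"
  shows "\<exists>G :: nat pair_pre_digraph.
           pair_graph G \<and> Digraph_Component.connected (with_proj G) \<and> regular_graph G \<and> graph_diameter G \<ge> 3 \<and>
           real (num_edges (graph_power G 3)) < c * real (min_degree G) * real (num_verts G)"
proof -
  define \<epsilon> where "\<epsilon> = 8 * c - 7"
  have \<epsilon>: "\<epsilon> > 0" using assms by (simp add: \<epsilon>_def)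
  obtain r :: nat where r: "10 / \<epsilon> < real r" using reals_Archimedean2 by blast
  then have "0 < real r" using \<epsilon> by (meson divide_pos_pos less_trans zero_less_numeral)
  define q where "q = 2 * r"
  have q: "even q" "q \<ge> 1" using \<open>0 < real r\<close> by (auto simp: q_def)
  \<comment> \<open>The claim amounts to \<open>\<epsilon> q\<^sup>2 + 6 c q > 8 q + 2\<close>, and \<open>8 q + 2 \<le> 10 q\<close>.\<close>
  have "10 < \<epsilon> * real q" using r \<epsilon> by (simp add: q_def field_simps)
  then have "10 * real q < \<epsilon> * real q * real q" using q by (intro mult_strict_right_mono) auto
  moreover have "0 \<le> 6 * c * real q" using assms by simp
  moreover have "real (num_edges (graph_power (layered q) 3)) + (real q + 1)^2
      \<le> (4 * real q + 3) * (2 * real q + 1)"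
    using of_nat_mono[OF num_edges_cube_layered[of q], where 'a = real]
    by (simp add: algebra_simps)
  ultimately have "real (num_edges (graph_power (layered q) 3)) < c * (2 * real q) * (4 * real q + 3)"
    using q by (simp add: \<epsilon>_def power2_eq_square algebra_simps)
  moreover have "num_verts (layered q) = 4*q+3" by (simp add: num_verts_def layered_def)
  moreover have "regular_graph (layered q)"
    using degree_layered[OF q(1)] by (auto simp: regular_graph_def)
  ultimately show ?thesis
    using pair_graph_layered connected_layered diameter_layered min_degree_layered[OF q(1)] q(2)
    by (intro exI[of _ "layered q"]) (auto simp: add.commute)
qed

end
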